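(* Let $G$ be a network and let $G_M$ be a reduced network associated to $G$, that is, a reduced network that is O.D.E. equivalent to $G$. Then $G_M$ is the unique (up to isomorphism) minimal network in the O.D.E. equivalence class of $G$.
   Context: A network (identical edge homogeneous coupled cell network) is a directed multigraph, loops allowed, in which every vertex has the same in-degree. It is given by a finite vertex set $V$ and an edge multiplicity function $E:V\times V\to\mathbb{N}$ (values are nonnegative integers; $E(u,v)$ is the number of edges from $u$ to $v$). It is an $n$ cell degree $r$ network if $|V|=n$ and $\sum_{u\in V}E(u,v)=r$ for all $v\in V$. Two networks are isomorphic if a bijection between their vertex sets carries one edge multiplicity function to the other. Admissible vector fields: let $G$ be an $n$ cell degree $r$ network with vertices $1,\dots,n$, and let $P=\mathbb{R}^d$ be a finite dimensional phase space. $\mathfrak{X}_G^P$ is the class of all vector fields on $P^n$ of the form $\dot x_i=F(x_i;x_{j^{(i)}_1},\dots,x_{j^{(i)}_r})$, $1\le i\le n$, where $j^{(i)}_1,\dots,j^{(i)}_r$ are the source vertices of the $r$ edges that terminate at vertex $i$, and $F:P\times P^r\to P$ is a function such that $F(x;y_1,\dots,y_r)$ is invariant under all permutations of $y_1,\dots,y_r$. Two $n$ cell networks $G_1$ and $G_2$ (possibly of different degrees) are O.D.E. equivalent if there exists a network $G_2'$ isomorphic to $G_2$ such that $\mathfrak{X}_{G_1}^P=\mathfrak{X}_{G_2'}^P$ for all choices of phase space $P$. A network is reduced if (1) at least one vertex has no loops, and (2) the greatest common divisor of the multiplicities of the edges is $1$. A network is minimal if its number of edges is minimal within its O.D.E.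 equivalence class.
   Formalization: The functions F defining admissible vector fields are required to be smooth (C^infinity); for arbitrary F the claim fails, e.g. for the two-cell networks with input rows (1 1), (2 0) and (2 1), (3 0). *)

theory Defs
  imports "HOL-Analysis.Analysis"
begin

record 'v network =
  verts :: "'v set"
  mult :: "'v \<Rightarrow> 'v \<Rightarrow> nat"

(* mult G u v is the number of edges from u to v; its values outside verts G are irrelevant. *)

definition has_degree :: "'v network \<Rightarrow> nat \<Rightarrow> bool" where
  "has_degree G r \<longleftrightarrow> (\<forall>v\<in>verts G. (\<Sum>u\<in>verts G. mult G u v) = r)"

definition network :: "'v network \<Rightarrow> bool" where
  "network G \<longleftrightarrow> finite (verts G) \<and> (\<exists>r. has_degree G r)"

definition isomorphic :: "'v network \<Rightarrow> 'w network \<Rightarrow> bool" where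
  "isomorphic G H \<longleftrightarrow>
     (\<exists>\<phi>. bij_betw \<phi> (verts G) (verts H) \<and>
          (\<forall>u\<in>verts G. \<forall>v\<in>verts G. mult H (\<phi> u) (\<phi> v) = mult G u v))"

definition num_edges :: "'v network \<Rightarrow> nat" where
  "num_edges G = (\<Sum>u\<in>verts G. \<Sum>v\<in>verts G. mult G u v)"

definition reduced_network :: "'v network \<Rightarrow> bool" where
  "reduced_network G \<longleftrightarrow>
     (\<exists>v\<in>verts G. mult G v v = 0) \<and>
     Gcd {mult G u v |u v. u \<in> verts G \<and> v \<in> verts G \<and> mult G u v > 0} = 1"


(* The dimension d of a phase space is quantified inside O.D.E. equivalence, so R^I for a
   finite index set I is rendered as I \<rightarrow>\<^sub>E UNIV, the underlying set of powertop_real I.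
   A function on it is C^k if all iterated partial derivatives of order at most k exist and
   are continuous. *)

primrec C_k :: "nat \<Rightarrow> 'i set \<Rightarrow> (('i \<Rightarrow> real) \<Rightarrow> real) \<Rightarrow> bool" where
  "C_k 0 I g \<longleftrightarrow> continuous_map (powertop_real I) euclideanreal g"
| "C_k (Suc k) I g \<longleftrightarrow>
     continuous_map (powertop_real I) euclideanreal g \<and>
     (\<forall>i\<in>I. \<exists>g'. (\<forall>z \<in> I \<rightarrow>\<^sub>E UNIV.
                    ((\<lambda>t. g (z(i := t))) has_real_derivative g' z) (at (z i))) \<and>
                C_k k I g')"

definition smooth_fun :: "'i set \<Rightarrow> (('i \<Rightarrow> real) \<Rightarrow> real) \<Rightarrow> bool" where
  "smooth_fun I g \<longleftrightarrow> (\<forall>k. C_k k I g)"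

type_synonym point = "nat \<Rightarrow> real"

definition phase :: "nat \<Rightarrow> point set" where
  "phase d = ({..<d} \<rightarrow>\<^sub>E UNIV)"

(* F : P \<times> P^r \<rightarrow> P is smooth, symmetric in the last r arguments. In the smoothness condition the
   coordinate (0, c) of z is coordinate c of the first argument, and (Suc k, c) is coordinate c of
   the k-th of the last r arguments. Smoothness is the standing meaning of "vector field" here:
   for arbitrary, or merely continuous, F the class of admissible vector fields does not
   determine a reduced network up to isomorphism (compare two cells with input rows (1 1), (2 0)
   with (2 1), (3 0)). *)

definition response :: "nat \<Rightarrow> nat \<Rightarrow> (point \<Rightarrow> (nat \<Rightarrow> point) \<Rightarrow> point) \<Rightarrow> bool" where
  "response d r F \<longleftrightarrow>
     (\<forall>x\<in>phase d. \<forall>y \<in> {..<r} \<rightarrow>\<^sub>E phase d. F x y \<in> phase d) \<and>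
     (\<forall>x\<in>phase d. \<forall>y \<in> {..<r} \<rightarrow>\<^sub>E phase d. \<forall>\<pi>. \<pi> permutes {..<r} \<longrightarrow>
        F x (\<lambda>k\<in>{..<r}. y (\<pi> k)) = F x y) \<and>
     (\<forall>c<d. smooth_fun ({..r} \<times> {..<d})
        (\<lambda>z. F (\<lambda>a\<in>{..<d}. z (0, a)) (\<lambda>k\<in>{..<r}. \<lambda>a\<in>{..<d}. z (Suc k, a)) c))"

(* s i 0, ..., s i (r - 1) lists the sources of the r edges that terminate at i. *)

definition source_listing :: "'v network \<Rightarrow> nat \<Rightarrow> ('v \<Rightarrow> nat \<Rightarrow> 'v) \<Rightarrow> bool" where
  "source_listing G r s \<longleftrightarrow>
     (\<forall>i\<in>verts G. (\<forall>k<r. s i k \<in> verts G) \<and>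
        (\<forall>u\<in>verts G. card {k. k < r \<and> s i k = u} = mult G u i))"

(* The admissible vector fields for the phase space R^d. The choice of the listing s is
   immaterial, because F is symmetric. *)

definition admissible :: "nat \<Rightarrow> 'v network \<Rightarrow> (('v \<Rightarrow> point) \<Rightarrow> ('v \<Rightarrow> point)) set" where
  "admissible d G =
     {f \<in> (verts G \<rightarrow>\<^sub>E phase d) \<rightarrow>\<^sub>E (verts G \<rightarrow>\<^sub>E phase d).
        \<exists>r s F. has_degree G r \<and> source_listing G r s \<and> response d r F \<and>
          (\<forall>x \<in> verts G \<rightarrow>\<^sub>E phase d. \<forall>i\<in>verts G.
             f x i = F (x i) (\<lambda>k\<in>{..<r}. x (s i k)))}"

definition ode_equiv :: "'v network \<Rightarrow> 'w network \<Rightarrow> bool" where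
  "ode_equiv G1 G2 \<longleftrightarrow>
     (\<exists>G2'. network G2' \<and> verts G2' = verts G1 \<and> isomorphic G2 G2' \<and>
        (\<forall>d. admissible d G1 = admissible d G2'))"

definition ode_class :: "'v network \<Rightarrow> 'v network set" where
  "ode_class G = {H. network H \<and> ode_equiv G H}"

definition minimal_network :: "'v network \<Rightarrow> bool" where
  "minimal_network G \<longleftrightarrow> network G \<and> (\<forall>H\<in>ode_class G. num_edges G \<le> num_edges H)"

end

theory Submission
  imports Defs
begin

text \<open>
  The linear parts of the admissible vector fields determine the network up to an affine change of
  its adjacency matrix. Write \<open>A\<close> for the matrix of multiplicities. On the phase space
  \<open>\<real>\<close> the linear field whose component at \<open>v\<close> is the sum of \<open>A\<^sub>H(u, v) x\<^sub>u\<close> over all \<open>u\<close>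
  is admissible for \<open>H\<close>. If it is also admissible for \<open>M\<close>, it has the form
  \<open>F(x\<^sub>i; \<dots>)\<close> with \<open>F\<close> smooth, and differentiating at the origin gives
  \<open>A\<^sub>H = \<alpha> A\<^sub>M + \<beta> I\<close>: \<open>\<beta>\<close> is the partial derivative of \<open>F\<close> in its first argument, and \<open>\<alpha>\<close> is
  its partial derivative in any other argument, the same for all of them by symmetry
  (\<open>coupling_field_admissible_imp_affine\<close>).

  Now let \<open>M\<close> be reduced and O.D.E. equivalent to \<open>H\<close>, with equal vertex sets. Then \<open>A\<^sub>M\<close> is
  not diagonal. The same argument with the two networks exchanged shows that \<open>A\<^sub>H\<close> is not diagonal
  either, so \<open>\<alpha> > 0\<close>. A vertex of \<open>M\<close> without loops shows that \<open>\<beta>\<close> is a natural number; hence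
  \<open>\<alpha>\<close> times every entry of \<open>A\<^sub>M\<close> is an integer, and since the entries have greatest common
  divisor 1, \<open>\<alpha>\<close> is a positive integer (\<open>reduced_affine\<close>). So \<open>H\<close> has
  \<open>\<alpha> e(M) + \<beta> n \<ge> e(M)\<close> edges, with equality only for \<open>\<alpha> = 1\<close>, \<open>\<beta> = 0\<close>, that is
  \<open>A\<^sub>H = A\<^sub>M\<close> (\<open>reduced_num_edges\<close>).

  Comparing two members of the class of \<open>G\<close> with each other requires symmetry and transitivity of
  O.D.E. equivalence. They follow from \<open>ode_equiv_euclidean\<close>, which carries admissible vector
  fields along network isomorphisms by conjugation.
\<close>

section \<open>Isomorphisms\<close>

definition network_iso :: "('v \<Rightarrow> 'w) \<Rightarrow> 'v network \<Rightarrow> 'w network \<Rightarrow> bool" where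
  "network_iso \<phi> G H \<longleftrightarrow> bij_betw \<phi> (verts G) (verts H) \<and>
     (\<forall>u\<in>verts G. \<forall>v\<in>verts G. mult H (\<phi> u) (\<phi> v) = mult G u v)"

lemma isomorphic_iff: "isomorphic G H \<longleftrightarrow> (\<exists>\<phi>. network_iso \<phi> G H)"
  by (simp add: isomorphic_def network_iso_def)

lemma network_iso_inv:
  assumes "network_iso \<phi> G H"
  shows "network_iso (inv_into (verts G) \<phi>) H G"
proof -
  have b: "bij_betw \<phi> (verts G) (verts H)"
    using assms by (simp add: network_iso_def)
  have "mult G (inv_into (verts G) \<phi> u) (inv_into (verts G) \<phi> v) = mult H u v"
    if "u \<in> verts H" "v \<in> verts H" for u v
    using assms that bij_betw_inv_into_right[OF b] bij_betwE[OF bij_betw_inv_into[OF b]]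
    unfolding network_iso_def by metis
  then show ?thesis
    using bij_betw_inv_into[OF b] by (simp add: network_iso_def)
qed

lemma isomorphic_sym: "isomorphic G H \<Longrightarrow> isomorphic H G"
  by (metis isomorphic_iff network_iso_inv)

lemma isomorphic_trans:
  assumes "isomorphic G H" "isomorphic H K"
  shows "isomorphic G K"
proof -
  obtain \<phi> \<psi> where p: "network_iso \<phi> G H" and q: "network_iso \<psi> H K"
    using assms isomorphic_iff by metis
  have "\<phi> u \<in> verts H" if "u \<in> verts G" for u
    using p that by (auto simp: network_iso_def dest: bij_betwE)
  then have "network_iso (\<psi> \<circ> \<phi>) G K"
    using p q by (auto simp: network_iso_def intro: bij_betw_trans)
  then show ?thesis
    using isomorphic_iff by blast
qed

lemma in_degree_iso:
  assumes "network_iso \<phi> G H" "v \<in> verts G"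
  shows "(\<Sum>u\<in>verts H. mult H u (\<phi> v)) = (\<Sum>u\<in>verts G. mult G u v)"
proof -
  have "(\<Sum>u\<in>verts H. mult H u (\<phi> v)) = (\<Sum>u\<in>verts G. mult H (\<phi> u) (\<phi> v))"
    using assms by (intro sum.reindex_bij_betw[symmetric]) (simp add: network_iso_def)
  then show ?thesis
    using assms by (simp add: network_iso_def)
qed

lemma has_degree_iso:
  assumes "network_iso \<phi> G H"
  shows "has_degree G r \<longleftrightarrow> has_degree H r"
proof -
  have im: "verts H = \<phi> ` verts G"
    using assms by (simp add: network_iso_def bij_betw_def)
  have "has_degree H r \<longleftrightarrow> (\<forall>v\<in>verts G. (\<Sum>u\<in>verts H. mult H u (\<phi> v)) = r)"
    by (simp add: has_degree_def im)
  then show ?thesis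
    using in_degree_iso[OF assms] by (simp add: has_degree_def)
qed

lemma network_iso_network:
  assumes "network_iso \<phi> G H"
  shows "network G \<longleftrightarrow> network H"
  using has_degree_iso[OF assms] assms bij_betw_finite
  unfolding network_def network_iso_def by blast

lemma num_edges_isomorphic:
  assumes "isomorphic G H"
  shows "num_edges G = num_edges H"
proof -
  obtain \<phi> where p: "network_iso \<phi> G H"
    using assms isomorphic_iff by metis
  then have b: "bij_betw \<phi> (verts G) (verts H)"
    by (simp add: network_iso_def)
  have "num_edges H = (\<Sum>v\<in>verts H. \<Sum>u\<in>verts H. mult H u v)"
    unfolding num_edges_def by (rule sum.swap)
  also have "\<dots> = (\<Sum>v\<in>verts G. \<Sum>u\<in>verts H. mult H u (\<phi> v))"
    by (rule sum.reindex_bij_betw[OF b, symmetric])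
  also have "\<dots> = (\<Sum>v\<in>verts G. \<Sum>u\<in>verts G. mult G u v)"
    using in_degree_iso[OF p] by simp
  also have "\<dots> = num_edges G"
    unfolding num_edges_def by (rule sum.swap)
  finally show ?thesis by simp
qed

section \<open>O.D.E. equivalence is a Euclidean relation\<close>

text \<open>
  The field \<open>g\<close> on \<open>P\<^sup>W\<close> pulled back to \<open>P\<^sup>V\<close> by relabelling the cells along \<open>\<phi>\<close>. The outer
  restrictions keep the result in the extensional function space over which admissible vector
  fields are compared by equality.
\<close>

definition conj_field ::
  "nat \<Rightarrow> 'v set \<Rightarrow> 'w set \<Rightarrow> ('v \<Rightarrow> 'w) \<Rightarrow> (('w \<Rightarrow> point) \<Rightarrow> ('w \<Rightarrow> point)) \<Rightarrow> (('v \<Rightarrow> point) \<Rightarrow> ('v \<Rightarrow> point))"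
  where
  "conj_field d V W \<phi> g =
     (\<lambda>x \<in> V \<rightarrow>\<^sub>E phase d. \<lambda>i\<in>V. g (\<lambda>j\<in>W. x (inv_into V \<phi> j)) (\<phi> i))"

lemma admissibleE:
  assumes "f \<in> admissible d G"
  obtains r s F where "has_degree G r" "source_listing G r s" "response d r F"
    "\<forall>x \<in> verts G \<rightarrow>\<^sub>E phase d. \<forall>i\<in>verts G. f x i = F (x i) (\<lambda>k\<in>{..<r}. x (s i k))"
proof -
  from assms have "\<exists>r s F. has_degree G r \<and> source_listing G r s \<and> response d r F \<and>
      (\<forall>x \<in> verts G \<rightarrow>\<^sub>E phase d. \<forall>i\<in>verts G. f x i = F (x i) (\<lambda>k\<in>{..<r}. x (s i k)))"
    by (simp add: admissible_def)
  then show ?thesis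
    using that by (elim exE conjE) simp
qed

lemma admissibleI:
  assumes "f \<in> (verts G \<rightarrow>\<^sub>E phase d) \<rightarrow>\<^sub>E (verts G \<rightarrow>\<^sub>E phase d)"
    and "has_degree G r" "source_listing G r s" "response d r F"
    and "\<And>x i. x \<in> verts G \<rightarrow>\<^sub>E phase d \<Longrightarrow> i \<in> verts G \<Longrightarrow>
      f x i = F (x i) (\<lambda>k\<in>{..<r}. x (s i k))"
  shows "f \<in> admissible d G"
  unfolding admissible_def
  by (intro CollectI conjI exI[of _ r] exI[of _ s] exI[of _ F] ballI assms)

text \<open>The response function stays the same; only the source listing is relabelled.\<close>

lemma conj_field_admissible:
  assumes iso: "network_iso \<phi> G H" and g: "g \<in> admissible d H"
  shows "conj_field d (verts G) (verts H) \<phi> g \<in> admissible d G"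
proof -
  let ?V = "verts G" and ?W = "verts H"
  let ?\<psi> = "inv_into ?V \<phi>"
  have b: "bij_betw \<phi> ?V ?W"
    and m: "\<And>u v. u \<in> ?V \<Longrightarrow> v \<in> ?V \<Longrightarrow> mult H (\<phi> u) (\<phi> v) = mult G u v"
    using iso by (auto simp: network_iso_def)
  have \<phi>: "\<phi> i \<in> ?W" "?\<psi> (\<phi> i) = i" if "i \<in> ?V" for i
    using b that by (auto simp: bij_betw_def)
  have \<psi>: "?\<psi> j \<in> ?V" "\<phi> (?\<psi> j) = j" if "j \<in> ?W" for j
    using b that bij_betw_inv_into_right[OF b] bij_betwE[OF bij_betw_inv_into[OF b]] by auto
  obtain r s F where deg: "has_degree H r" and s: "source_listing H r s" and F: "response d r F"
    and gF: "\<forall>x \<in> ?W \<rightarrow>\<^sub>E phase d. \<forall>i\<in>?W. g x i = F (x i) (\<lambda>k\<in>{..<r}. x (s i k))"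
    using admissibleE[OF g] .
  have gext: "g \<in> (?W \<rightarrow>\<^sub>E phase d) \<rightarrow>\<^sub>E (?W \<rightarrow>\<^sub>E phase d)"
    using g by (simp add: admissible_def)
  have sW: "s i k \<in> ?W" if "i \<in> ?W" "k < r" for i k
    using s that by (simp add: source_listing_def)
  define s' where "s' i k = ?\<psi> (s (\<phi> i) k)" for i k
  have listing: "source_listing G r s'"
    unfolding source_listing_def
  proof (intro ballI conjI allI impI)
    fix i k assume "i \<in> ?V" "k < r"
    then show "s' i k \<in> ?V"
      using \<phi> \<psi> sW by (simp add: s'_def)
  next
    fix i u assume i: "i \<in> ?V" and u: "u \<in> ?V"
    have "{k. k < r \<and> s' i k = u} = {k. k < r \<and> s (\<phi> i) k = \<phi> u}"
      using i u \<phi> \<psi> sW by (auto simp: s'_def)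
    then show "card {k. k < r \<and> s' i k = u} = mult G u i"
      using s i u \<phi> m by (simp add: source_listing_def)
  qed
  have x': "(\<lambda>j\<in>?W. x (?\<psi> j)) \<in> ?W \<rightarrow>\<^sub>E phase d" if "x \<in> ?V \<rightarrow>\<^sub>E phase d" for x
    using that \<psi> by (auto simp: PiE_iff)
  have eq: "conj_field d ?V ?W \<phi> g x i = F (x i) (\<lambda>k\<in>{..<r}. x (s' i k))"
    if x: "x \<in> ?V \<rightarrow>\<^sub>E phase d" and i: "i \<in> ?V" for x i
  proof -
    have "(\<lambda>k\<in>{..<r}. (\<lambda>j\<in>?W. x (?\<psi> j)) (s (\<phi> i) k)) = (\<lambda>k\<in>{..<r}. x (s' i k))"
      using sW \<phi> i by (auto simp: s'_def fun_eq_iff)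
    then show ?thesis
      using gF[rule_format, OF x'[OF x] \<phi>(1)[OF i]] x i \<phi> by (simp add: conj_field_def)
  qed
  have maps: "conj_field d ?V ?W \<phi> g \<in> (?V \<rightarrow>\<^sub>E phase d) \<rightarrow>\<^sub>E (?V \<rightarrow>\<^sub>E phase d)"
  proof -
    have "g (\<lambda>j\<in>?W. x (?\<psi> j)) (\<phi> i) \<in> phase d" if "x \<in> ?V \<rightarrow>\<^sub>E phase d" "i \<in> ?V" for x i
      using PiE_mem[OF PiE_mem[OF gext x'[OF that(1)]] \<phi>(1)[OF that(2)]] .
    then show ?thesis
      unfolding conj_field_def by (intro restrict_PiE_iff[THEN iffD2] ballI) auto
  qed
  from has_degree_iso[OF iso] deg have "has_degree G r" by simp
  from admissibleI[OF maps this listing F eq] show ?thesis .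
qed

lemma conj_field_inverse:
  assumes b: "bij_betw \<phi> V W" and f: "f \<in> (V \<rightarrow>\<^sub>E phase d) \<rightarrow>\<^sub>E (V \<rightarrow>\<^sub>E phase d)"
  shows "conj_field d V W \<phi> (conj_field d W V (inv_into V \<phi>) f) = f"
proof (rule extensionalityI)
  show "conj_field d V W \<phi> (conj_field d W V (inv_into V \<phi>) f) \<in> extensional (V \<rightarrow>\<^sub>E phase d)"
    by (simp add: conj_field_def)
  show "f \<in> extensional (V \<rightarrow>\<^sub>E phase d)"
    using f by (simp add: PiE_iff)
  fix x assume x: "x \<in> V \<rightarrow>\<^sub>E phase d"
  let ?\<psi> = "inv_into V \<phi>"
  have \<psi>: "?\<psi> j \<in> V" if "j \<in> W" for j
    using bij_betwE[OF bij_betw_inv_into[OF b]] that by auto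
  have \<phi>: "\<phi> i \<in> W" "?\<psi> (\<phi> i) = i" "inv_into W ?\<psi> i = \<phi> i" if "i \<in> V" for i
    using b that by (auto simp: bij_betw_def inv_into_inv_into_eq[OF b])
  have x': "(\<lambda>j\<in>W. x (?\<psi> j)) \<in> W \<rightarrow>\<^sub>E phase d"
    using x \<psi> by (auto simp: PiE_iff)
  have "(\<lambda>i\<in>V. (\<lambda>j\<in>W. x (?\<psi> j)) (inv_into W ?\<psi> i)) = x"
    using x \<phi> by (auto simp: fun_eq_iff PiE_iff extensional_def)
  then have "conj_field d V W \<phi> (conj_field d W V ?\<psi> f) x i = f x i" if "i \<in> V" for i
    using x x' \<phi>[OF that] that unfolding conj_field_def by simp
  moreover have "f x \<in> extensional V"
    using f x by (auto simp: PiE_iff)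
  moreover have "conj_field d V W \<phi> (conj_field d W V ?\<psi> f) x \<in> extensional V"
    using x by (simp add: conj_field_def)
  ultimately show "conj_field d V W \<phi> (conj_field d W V ?\<psi> f) x = f x"
    by (intro extensionalityI[where A = V])
qed

lemma admissible_iso:
  assumes iso: "network_iso \<phi> G H"
  shows "admissible d G = conj_field d (verts G) (verts H) \<phi> ` admissible d H"
proof (intro equalityI subsetI)
  fix f assume f: "f \<in> admissible d G"
  then have "f \<in> (verts G \<rightarrow>\<^sub>E phase d) \<rightarrow>\<^sub>E (verts G \<rightarrow>\<^sub>E phase d)"
    by (simp add: admissible_def)
  moreover have "bij_betw \<phi> (verts G) (verts H)"
    using iso by (simp add: network_iso_def)
  ultimately have "f = conj_field d (verts G) (verts H) \<phi>
      (conj_field d (verts H) (verts G) (inv_into (verts G) \<phi>) f)"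
    using conj_field_inverse by metis
  then show "f \<in> conj_field d (verts G) (verts H) \<phi> ` admissible d H"
    using conj_field_admissible[OF network_iso_inv[OF iso] f] by blast
qed (use conj_field_admissible[OF iso] in blast)

text \<open>The network \<open>K'\<close> realising \<open>K\<close> on the cells of \<open>G\<close> is moved to the cells of \<open>H\<close> along the
  isomorphism from \<open>H\<close>. The admissible fields of \<open>H\<close> and of the moved network are then
  conjugates, by the same map, of one and the same class, that of \<open>G\<close>.\<close>

lemma ode_equiv_euclidean:
  assumes "ode_equiv G H" "ode_equiv G K"
  shows "ode_equiv H K"
proof -
  obtain H' where vH: "verts H' = verts G" and "isomorphic H H'"
    and aH: "\<And>d. admissible d G = admissible d H'"
    using assms(1) unfolding ode_equiv_def by blast
  then obtain \<phi> where \<phi>: "network_iso \<phi> H H'"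
    using isomorphic_iff by metis
  obtain K' where nK: "network K'" and vK: "verts K' = verts G" and iK: "isomorphic K K'"
    and aK: "\<And>d. admissible d G = admissible d K'"
    using assms(2) unfolding ode_equiv_def by blast
  define L where "L = \<lparr>verts = verts H, mult = \<lambda>u v. mult K' (\<phi> u) (\<phi> v)\<rparr>"
  have L: "network_iso \<phi> L K'"
    using \<phi> vH vK by (simp add: network_iso_def L_def)
  have "admissible d H = admissible d L" for d
    using admissible_iso[OF \<phi>, of d] admissible_iso[OF L, of d] aH[of d] aK[of d] vH vK
    by (simp add: L_def)
  moreover have "isomorphic K L"
    using iK L isomorphic_iff isomorphic_sym isomorphic_trans by blast
  moreover have "network L"
    using nK network_iso_network[OF L] by simp
  ultimately show ?thesis
    unfolding ode_equiv_def by (intro exI[of _ L]) (simp add: L_def)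
qed

section \<open>The linear coupling field\<close>

text \<open>The edges into \<open>i\<close> are modelled as pairs of a source \<open>u\<close> and an index below the multiplicity of
  the edge; there are \<open>r\<close> of them, and any enumeration lists the sources.\<close>

lemma source_listing_exists:
  assumes "finite (verts G)" "has_degree G r"
  shows "\<exists>s. source_listing G r s"
proof -
  let ?V = "verts G"
  have "\<exists>t. (\<forall>k<r. t k \<in> ?V) \<and> (\<forall>u\<in>?V. card {k. k < r \<and> t k = u} = mult G u i)"
    if "i \<in> ?V" for i
  proof -
    let ?S = "SIGMA u:?V. {..<mult G u i}"
    have "finite ?S" "card ?S = r"
      using assms that by (auto simp: has_degree_def card_SigmaI)
    then obtain h where h: "bij_betw h {0..<r} ?S"
      using ex_bij_betw_nat_finite by metis
    have "card {k. k < r \<and> fst (h k) = u} = mult G u i" if u: "u \<in> ?V" for u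
    proof -
      have "h ` {k. k < r \<and> fst (h k) = u} = {u} \<times> {..<mult G u i}"
      proof (intro equalityI subsetI)
        fix p assume "p \<in> h ` {k. k < r \<and> fst (h k) = u}"
        then show "p \<in> {u} \<times> {..<mult G u i}"
          using bij_betwE[OF h] by (force simp: mem_Times_iff)
      next
        fix p assume p: "p \<in> {u} \<times> {..<mult G u i}"
        then have "p \<in> h ` {0..<r}"
          using u bij_betw_imp_surj_on[OF h] by auto
        then obtain k where "k < r" "p = h k" by auto
        moreover have "fst p = u" using p by auto
        ultimately show "p \<in> h ` {k. k < r \<and> fst (h k) = u}" by blast
      qed
      moreover have "inj_on h {k. k < r \<and> fst (h k) = u}"
        by (rule inj_on_subset[OF bij_betw_imp_inj_on[OF h]]) auto
      ultimately show ?thesis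
        using card_image by fastforce
    qed
    moreover have "fst (h k) \<in> ?V" if "k < r" for k
      using bij_betwE[OF h] that by (force simp: mem_Times_iff)
    ultimately show ?thesis
      by (intro exI[of _ "fst \<circ> h"]) simp
  qed
  then show ?thesis
    unfolding source_listing_def by (intro bchoice) blast
qed

lemma C_k_const: "C_k k I (\<lambda>_. c)"
proof (induction k arbitrary: c)
  case (Suc k)
  then show ?case
    by (auto intro!: exI[of _ "\<lambda>_. 0"])
qed simp

lemma C_k_coordinate_sum:
  assumes "finite J" "J \<subseteq> I"
  shows "C_k k I (\<lambda>z. \<Sum>j\<in>J. z j)"
proof -
  have cont: "continuous_map (powertop_real I) euclideanreal (\<lambda>z. \<Sum>j\<in>J. z j)"
    using assms by (intro continuous_map_sum continuous_map_product_projection) auto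
  have der: "((\<lambda>t. \<Sum>j\<in>J. (z(i := t)) j) has_real_derivative (if i \<in> J then 1 else 0)) (at (z i))"
    for z i
  proof -
    have "(\<lambda>t. \<Sum>j\<in>J. (z(i := t)) j) =
        (\<lambda>t. (if i \<in> J then 1 else 0) * t + (\<Sum>j\<in>J - {i}. z j))"
      using assms by (auto simp: fun_eq_iff sum.remove intro!: sum.cong)
    then show ?thesis
      by (auto intro!: derivative_eq_intros)
  qed
  show ?thesis
  proof (cases k)
    case (Suc l)
    show ?thesis
      unfolding Suc C_k.simps
    proof (intro conjI cont ballI)
      fix i
      show "\<exists>g'. (\<forall>z\<in>I \<rightarrow>\<^sub>E UNIV.
          ((\<lambda>t. \<Sum>j\<in>J. (z(i := t)) j) has_real_derivative g' z) (at (z i))) \<and> C_k l I g'"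
        by (intro exI[of _ "\<lambda>_. if i \<in> J then 1 else 0"] conjI ballI der C_k_const)
    qed
  qed (simp add: cont)
qed

definition coupling_field ::
    "nat \<Rightarrow> 'v network \<Rightarrow> ('v \<Rightarrow> point) \<Rightarrow> ('v \<Rightarrow> point)" where
  "coupling_field d G =
     (\<lambda>x \<in> verts G \<rightarrow>\<^sub>E phase d. \<lambda>i\<in>verts G. \<lambda>c\<in>{..<d}. \<Sum>u\<in>verts G. real (mult G u i) * x u c)"

lemma response_sum: "response d r (\<lambda>x y. \<lambda>c\<in>{..<d}. \<Sum>k<r. y k c)"
  unfolding response_def
proof (intro conjI ballI allI impI)
  fix x :: point and y :: "nat \<Rightarrow> point" and \<pi>
  assume "\<pi> permutes {..<r}"
  then have "(\<Sum>k<r. y (\<pi> k) c) = (\<Sum>k<r. y k c)" for c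
    using sum.permute[of \<pi> "{..<r}" "\<lambda>k. y k c"] by simp
  then show "(\<lambda>c\<in>{..<d}. \<Sum>k<r. (\<lambda>k\<in>{..<r}. y (\<pi> k)) k c) = (\<lambda>c\<in>{..<d}. \<Sum>k<r. y k c)"
    by (intro restrict_ext) simp
next
  fix c assume c: "c < d"
  let ?J = "(\<lambda>k. (Suc k, c)) ` {..<r}"
  have "(\<Sum>k<r. z (Suc k, c)) = (\<Sum>j\<in>?J. z j)" for z :: "nat \<times> nat \<Rightarrow> real"
    by (simp add: sum.reindex inj_on_def)
  moreover have "smooth_fun ({..r} \<times> {..<d}) (\<lambda>z. \<Sum>j\<in>?J. z j)"
    unfolding smooth_fun_def using c by (intro allI C_k_coordinate_sum) auto
  ultimately show "smooth_fun ({..r} \<times> {..<d}) (\<lambda>z. (\<lambda>c\<in>{..<d}. \<Sum>k<r.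
      (\<lambda>k\<in>{..<r}. \<lambda>a\<in>{..<d}. z (Suc k, a)) k c) c)"
    using c by simp
qed (simp add: phase_def)

lemma coupling_field_admissible:
  assumes "network G"
  shows "coupling_field d G \<in> admissible d G"
proof -
  let ?V = "verts G"
  have fin: "finite ?V"
    using assms by (simp add: network_def)
  obtain r where r: "has_degree G r"
    using assms by (auto simp: network_def)
  then obtain s where s: "source_listing G r s"
    using source_listing_exists[OF fin] by blast
  have eq: "coupling_field d G x i = (\<lambda>c\<in>{..<d}. \<Sum>k<r. (\<lambda>k\<in>{..<r}. x (s i k)) k c)"
    if "x \<in> ?V \<rightarrow>\<^sub>E phase d" "i \<in> ?V" for x i
  proof -
    have "(\<Sum>k<r. x (s i k) c) = (\<Sum>u\<in>?V. real (mult G u i) * x u c)" for c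
    proof -
      have "(\<Sum>k<r. x (s i k) c) = (\<Sum>u\<in>?V. \<Sum>k | k \<in> {..<r} \<and> s i k = u. x (s i k) c)"
        using that s fin
        by (intro sum.group[symmetric]) (auto simp: source_listing_def)
      also have "\<dots> = (\<Sum>u\<in>?V. real (mult G u i) * x u c)"
        using that s by (intro sum.cong) (auto simp: source_listing_def)
      finally show ?thesis .
    qed
    then show ?thesis
      using that by (simp add: coupling_field_def cong: restrict_cong)
  qed
  have maps: "coupling_field d G \<in> (?V \<rightarrow>\<^sub>E phase d) \<rightarrow>\<^sub>E (?V \<rightarrow>\<^sub>E phase d)"
    by (auto simp: coupling_field_def phase_def)
  show ?thesis
    by (rule admissibleI[OF maps r s response_sum eq])
qed

section \<open>Linear parts of admissible vector fields\<close>

text \<open>The chain rule at the origin in the direction of the indicator vector of \<open>S\<close>, for a function with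
  continuous partial derivatives on a product of lines. One coordinate is switched on at a
  time: by the mean value theorem the increment along coordinate \<open>i\<close> equals \<open>t\<close> times the partial
  derivative at an intermediate point, which tends to the origin with \<open>t\<close>.\<close>

lemma partial_derivative_sum:
  fixes g :: "('i \<Rightarrow> real) \<Rightarrow> real" and p :: "'i \<Rightarrow> ('i \<Rightarrow> real) \<Rightarrow> real"
  assumes "finite S" "S \<subseteq> I"
    and der: "\<And>i z. i \<in> I \<Longrightarrow> z \<in> I \<rightarrow>\<^sub>E UNIV \<Longrightarrow>
      ((\<lambda>t. g (z(i := t))) has_real_derivative p i z) (at (z i))"
    and cont: "\<And>i. i \<in> I \<Longrightarrow> continuous_map (powertop_real I) euclideanreal (p i)"
  shows "((\<lambda>t. g (\<lambda>i\<in>I. if i \<in> S then t else 0)) has_real_derivative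
           (\<Sum>i\<in>S. p i (\<lambda>i\<in>I. 0))) (at 0)"
  using assms(1,2)
proof (induction S rule: finite_induct)
  case empty
  then show ?case by simp
next
  case (insert i S)
  let ?w = "\<lambda>t. \<lambda>j\<in>I. if j \<in> S then t else (0::real)"
  let ?origin = "\<lambda>j\<in>I. (0::real)"
  have i: "i \<in> I" "i \<notin> S" using insert by auto
  have upd: "(\<lambda>j\<in>I. if j \<in> insert i S then t else 0) = (?w t)(i := t)" for t :: real
    using i by (auto simp: fun_eq_iff)
  have same: "(?w t)(i := 0) = ?w t" for t
    using i by (auto simp: fun_eq_iff)
  have line: "((\<lambda>x. g ((?w t)(i := x))) has_real_derivative p i ((?w t)(i := x))) (at x)" for t x
    using der[OF i(1), of "(?w t)(i := x)"] i by (auto simp: PiE_iff extensional_def)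
  have "\<exists>\<theta>. \<bar>\<theta>\<bar> \<le> \<bar>t\<bar> \<and> g ((?w t)(i := t)) - g (?w t) = t * p i ((?w t)(i := \<theta>))" for t
  proof (cases t "0::real" rule: linorder_cases)
    case less
    from MVT2[OF this, of "\<lambda>x. g ((?w t)(i := x))" "\<lambda>x. p i ((?w t)(i := x))"] line
    obtain \<theta> where "t < \<theta>" "\<theta> < 0"
      "g ((?w t)(i := 0)) - g ((?w t)(i := t)) = (0 - t) * p i ((?w t)(i := \<theta>))"
      by blast
    then show ?thesis
      by (intro exI[of _ \<theta>]) (simp only: same, simp)
  next
    case greater
    from MVT2[OF this, of "\<lambda>x. g ((?w t)(i := x))" "\<lambda>x. p i ((?w t)(i := x))"] line
    obtain \<theta> where "0 < \<theta>" "\<theta> < t"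
      "g ((?w t)(i := t)) - g ((?w t)(i := 0)) = (t - 0) * p i ((?w t)(i := \<theta>))"
      by blast
    then show ?thesis
      by (intro exI[of _ \<theta>]) (simp only: same, simp)
  qed (auto simp: same)
  then obtain \<theta> where \<theta>: "\<And>t. \<bar>\<theta> t\<bar> \<le> \<bar>t\<bar>"
    and mvt: "\<And>t. g ((?w t)(i := t)) - g (?w t) = t * p i ((?w t)(i := \<theta> t))"
    by metis
  have \<theta>0: "(\<theta> \<longlongrightarrow> 0) (at 0)"
    by (rule tendsto_rabs_zero_cancel, rule tendsto_sandwich[of "\<lambda>_. 0" _ _ abs])
       (auto simp: \<theta> intro!: tendsto_eq_intros)
  have comp: "((\<lambda>t. ((?w t)(i := \<theta> t)) j) \<longlongrightarrow> ?origin j) (at 0)" if "j \<in> I" for j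
    by (cases "j = i"; cases "j \<in> S") (use that \<theta>0 in \<open>simp_all add: tendsto_ident_at\<close>)
  have "(?w t)(i := \<theta> t) \<in> I \<rightarrow>\<^sub>E UNIV" for t
    using i by (auto simp: PiE_iff extensional_def)
  then have "limitin (powertop_real I) (\<lambda>t. (?w t)(i := \<theta> t)) ?origin (at 0)"
    unfolding limitin_componentwise
    using i comp by (auto simp: extensional_def simp del: fun_upd_apply)
  from continuous_map_limit[OF cont[OF i(1)] this]
  have lim: "((\<lambda>t. p i ((?w t)(i := \<theta> t))) \<longlongrightarrow> p i ?origin) (at 0)"
    by (simp add: o_def)
  have "((\<lambda>t. g ((?w t)(i := t)) - g (?w t)) has_real_derivative p i ?origin) (at 0)"
    unfolding has_field_derivative_iff mvt
    by (rule Lim_transform_eventually[OF lim]) (auto simp: eventually_at_filter)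
  moreover have "((\<lambda>t. g (?w t)) has_real_derivative (\<Sum>j\<in>S. p j ?origin)) (at 0)"
    using insert.IH insert.prems by blast
  ultimately have "((\<lambda>t. g ((?w t)(i := t)) - g (?w t) + g (?w t)) has_real_derivative
      p i ?origin + (\<Sum>j\<in>S. p j ?origin)) (at 0)"
    by (rule DERIV_add)
  then show ?case
    by (simp only: upd sum.insert[OF insert.hyps] diff_add_cancel)
qed

text \<open>The linear field of \<open>H\<close> is evaluated along the line on which only cell \<open>u\<close> is excited. Its
  component at \<open>v\<close> is \<open>mult H u v\<close> times the parameter. On the other hand it is a response function
  with the parameter inserted in the \<open>mult G u v\<close> inputs of \<open>v\<close> coming from \<open>u\<close>, and in the
  internal variable if \<open>u = v\<close>. The two derivatives at the origin are compared.\<close>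

lemma coupling_field_admissible_imp_affine:
  assumes verts: "verts H = verts G" and fin: "finite (verts G)"
    and adm: "coupling_field 1 H \<in> admissible 1 G"
  obtains a b :: real where
    "\<And>u v. u \<in> verts G \<Longrightarrow> v \<in> verts G \<Longrightarrow>
      real (mult H u v) = a * real (mult G u v) + (if u = v then b else 0)"
proof -
  let ?V = "verts G"
  obtain r s F where "has_degree G r" and s: "source_listing G r s" and F: "response 1 r F"
    and fF: "\<forall>x \<in> ?V \<rightarrow>\<^sub>E phase 1. \<forall>i\<in>?V. coupling_field 1 H x i = F (x i) (\<lambda>k\<in>{..<r}. x (s i k))"
    using admissibleE[OF adm] .
  let ?I = "{..r} \<times> {..<1::nat}"
  define g where "g z = F (\<lambda>a\<in>{..<1}. z (0, a)) (\<lambda>k\<in>{..<r}. \<lambda>a\<in>{..<1}. z (Suc k, a)) 0"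
    for z :: "nat \<times> nat \<Rightarrow> real"
  have "C_k (Suc 0) ?I g"
    using F unfolding response_def smooth_fun_def g_def by blast
  then have "\<forall>i\<in>?I. \<exists>g'. (\<forall>z \<in> ?I \<rightarrow>\<^sub>E UNIV.
      ((\<lambda>t. g (z(i := t))) has_real_derivative g' z) (at (z i))) \<and>
      continuous_map (powertop_real ?I) euclideanreal g'"
    unfolding C_k.simps by blast
  from bchoice[OF this] obtain p where
    der: "\<And>i z. i \<in> ?I \<Longrightarrow> z \<in> ?I \<rightarrow>\<^sub>E UNIV \<Longrightarrow>
        ((\<lambda>t. g (z(i := t))) has_real_derivative p i z) (at (z i))"
    and cont: "\<And>i. i \<in> ?I \<Longrightarrow> continuous_map (powertop_real ?I) euclideanreal (p i)"
    by blast
  define D where "D i = p i (\<lambda>i\<in>?I. 0)" for i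
  have dir: "((\<lambda>t. g (\<lambda>i\<in>?I. if i \<in> S then t else 0)) has_real_derivative sum D S) (at 0)"
    if "S \<subseteq> ?I" for S
    unfolding D_def
    by (rule partial_derivative_sum[OF _ that der cont]) (use that finite_subset in blast)+
  \<comment> \<open>Exciting only input \<open>k\<close> or only input 0 gives the same response, by the transposition of the two.\<close>
  have D_eq: "D (Suc k, 0) = D (Suc 0, 0)" if k: "k < r" for k
  proof -
    let ?\<pi> = "Transposition.transpose 0 k"
    have \<pi>: "?\<pi> permutes {..<r}"
      using k by (intro permutes_swap_id) auto
    have "g (\<lambda>i\<in>?I. if i \<in> {(Suc k, 0)} then t else 0) =
          g (\<lambda>i\<in>?I. if i \<in> {(Suc 0, 0)} then t else 0)" for t
    proof -
      define y where "y = (\<lambda>j\<in>{..<r}. \<lambda>a\<in>{..<1::nat}. if j = 0 then t else 0)"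
      have "y \<in> {..<r} \<rightarrow>\<^sub>E phase 1" "(\<lambda>a\<in>{..<1::nat}. 0) \<in> phase 1"
        by (auto simp: y_def phase_def)
      then have "F (\<lambda>a\<in>{..<1}. 0) (\<lambda>j\<in>{..<r}. y (?\<pi> j)) = F (\<lambda>a\<in>{..<1}. 0) y"
        using F \<pi> unfolding response_def by blast
      moreover have "(\<lambda>j\<in>{..<r}. y (?\<pi> j)) =
          (\<lambda>j\<in>{..<r}. \<lambda>a\<in>{..<1::nat}. if j = k then t else 0)"
        using k by (auto simp: y_def fun_eq_iff Transposition.transpose_def)
      ultimately show ?thesis
        by (simp add: g_def y_def cong: restrict_cong)
    qed
    then show ?thesis
      using dir[of "{(Suc k, 0)}"] dir[of "{(Suc 0, 0)}"] k DERIV_unique by fastforce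
  qed
  have "real (mult H u v) = D (Suc 0, 0) * real (mult G u v) + (if u = v then D (0, 0) else 0)"
    if u: "u \<in> ?V" and v: "v \<in> ?V" for u v
  proof -
    let ?K = "{k. k < r \<and> s v k = u}"
    let ?B = "if u = v then {(0, 0)} else {} :: (nat \<times> nat) set"
    \<comment> \<open>The coordinates of the response function that see the excited cell \<open>u\<close>.\<close>
    let ?S = "?B \<union> (\<lambda>k. (Suc k, 0)) ` ?K"
    have "g (\<lambda>i\<in>?I. if i \<in> ?S then t else 0) = real (mult H u v) * t" for t
    proof -
      define x where "x = (\<lambda>w\<in>?V. \<lambda>a\<in>{..<1::nat}. if w = u then t else 0)"
      have x: "x \<in> ?V \<rightarrow>\<^sub>E phase 1"
        by (auto simp: x_def phase_def)
      have "(\<lambda>a\<in>{..<1}. (\<lambda>i\<in>?I. if i \<in> ?S then t else 0) (0, a)) = x v"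
        using v by (auto simp: x_def fun_eq_iff)
      moreover have "(\<lambda>k\<in>{..<r}. \<lambda>a\<in>{..<1}. (\<lambda>i\<in>?I. if i \<in> ?S then t else 0) (Suc k, a)) =
          (\<lambda>k\<in>{..<r}. x (s v k))"
        using v s by (auto simp: x_def fun_eq_iff source_listing_def)
      ultimately have "g (\<lambda>i\<in>?I. if i \<in> ?S then t else 0) = coupling_field 1 H x v 0"
        using fF[rule_format, OF x v] by (simp add: g_def)
      also have "\<dots> = (\<Sum>w\<in>?V. real (mult H w v) * (if w = u then t else 0))"
        using x v verts by (simp add: coupling_field_def x_def)
      also have "\<dots> = real (mult H u v) * t"
        using fin u by (simp add: mult_delta_right)
      finally show ?thesis .
    qed
    moreover have "((\<lambda>t. real (mult H u v) * t) has_real_derivative real (mult H u v)) (at 0)"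
      by (auto intro!: derivative_eq_intros)
    moreover have "?S \<subseteq> ?I" by auto
    ultimately have "real (mult H u v) = sum D ?S"
      using dir[of ?S] DERIV_unique by (simp only:) blast
    also have "\<dots> = sum D ?B + sum D ((\<lambda>k. (Suc k, 0)) ` ?K)"
      by (intro sum.union_disjoint) auto
    also have "sum D ((\<lambda>k. (Suc k, 0)) ` ?K) = (\<Sum>k\<in>?K. D (Suc k, 0))"
      by (simp add: sum.reindex inj_on_def)
    also have "\<dots> = (\<Sum>k\<in>?K. D (Suc 0, 0))"
      by (intro sum.cong refl D_eq) simp
    also have "\<dots> = D (Suc 0, 0) * real (mult G u v)"
      using s u v by (simp add: source_listing_def)
    finally show ?thesis by auto
  qed
  then show ?thesis using that by blast
qed

section \<open>Reduced networks\<close>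

text \<open>A network of constant in-degree without edges between distinct vertices has equally many loops at
  every vertex; since one vertex has none, there would be no edges at all, and the greatest common
  divisor of the empty set is 0.\<close>

lemma reduced_network_edge:
  assumes "network M" "reduced_network M"
  obtains u v where "u \<in> verts M" "v \<in> verts M" "u \<noteq> v" "mult M u v > 0"
proof -
  note edgeI = that
  have fin: "finite (verts M)" using assms by (simp add: network_def)
  obtain r where r: "\<And>v. v \<in> verts M \<Longrightarrow> (\<Sum>u\<in>verts M. mult M u v) = r"
    using assms(1) by (auto simp: network_def has_degree_def)
  obtain w where w: "w \<in> verts M" "mult M w w = 0"
    using assms(2) by (auto simp: reduced_network_def)
  show ?thesis
  proof (rule ccontr)
    assume none: "\<not> ?thesis"
    have off: "mult M u v = 0" if "u \<in> verts M" "v \<in> verts M" "u \<noteq> v" for u v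
      using none edgeI[OF that] by blast
    have diag: "mult M v v = r" if "v \<in> verts M" for v
    proof -
      have "(\<Sum>u\<in>verts M. mult M u v) = (\<Sum>u\<in>verts M. if u = v then mult M v v else 0)"
        using off that by (intro sum.cong) auto
      then show ?thesis using r that fin by simp
    qed
    have "r = 0"
      using diag w by simp
    then have "mult M u v = 0" if "u \<in> verts M" "v \<in> verts M" for u v
      using off diag that by (cases "u = v") auto
    then have no_edges: "{mult M u v |u v. u \<in> verts M \<and> v \<in> verts M \<and> mult M u v > 0} = {}"
      by fastforce
    show False
      using assms(2) unfolding reduced_network_def no_edges by simp
  qed
qed

text \<open>A real multiplier that turns all of \<open>A\<close> into natural numbers is a fraction \<open>n / q\<close> with \<open>q\<close>
  in \<open>A\<close>, unless \<open>A\<close> has no nonzero element. Then \<open>q\<close> divides \<open>n * m\<close> for all \<open>m\<close> in \<open>A\<close>, hence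
  also \<open>n * Gcd A\<close>.\<close>

lemma real_mult_Gcd_Nats:
  fixes A :: "nat set" and a :: real
  assumes "\<And>m. m \<in> A \<Longrightarrow> a * real m \<in> \<nat>"
  shows "a * real (Gcd A) \<in> \<nat>"
proof (cases "A \<subseteq> {0}")
  case True
  then have "Gcd A = 0"
    by simp
  then show ?thesis
    by (simp only: of_nat_0 mult_zero_right Nats_0)
next
  case False
  then obtain q where q: "q \<in> A" "q > 0" by auto
  obtain n where n: "a * real q = real n"
    using assms[OF q(1)] by (auto elim: Nats_cases)
  have a: "a = real n / real q"
    using n q by (simp add: field_simps)
  have "q dvd n * m" if "m \<in> A" for m
  proof -
    have "a * real m \<in> \<nat>"
      using assms that by blast
    then obtain l where "a * real m = real l"
      by (auto elim: Nats_cases)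
    then have "real (n * m) = real (q * l)"
      using q by (simp add: a field_simps)
    then have "n * m = q * l"
      by (simp only: of_nat_eq_iff)
    then show ?thesis by simp
  qed
  then have "q dvd Gcd ((*) n ` A)"
    by (intro Gcd_greatest) auto
  then have "q dvd n * Gcd A"
    by (simp add: Gcd_mult)
  then obtain l where "n * Gcd A = q * l" ..
  then have "real n * real (Gcd A) = real q * real l"
    by (metis of_nat_mult)
  then have "a * real (Gcd A) = real l"
    using q by (simp add: a field_simps)
  then show ?thesis by simp
qed

text \<open>The inclusion of the field of \<open>H\<close> gives real coefficients. The inclusion of the field of \<open>M\<close>
  excludes a zero leading coefficient, which would make the matrix of \<open>H\<close> diagonal, and each of
  the two conditions in the definition of a reduced network makes one coefficient a natural number.\<close>

lemma reduced_affine: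
  assumes M: "network M" "reduced_network M" and H: "network H"
    and verts: "verts H = verts M" and adm: "admissible 1 M = admissible 1 H"
  obtains a b :: nat where "a > 0"
    "\<And>u v. u \<in> verts M \<Longrightarrow> v \<in> verts M \<Longrightarrow>
      mult H u v = a * mult M u v + (if u = v then b else 0)"
proof -
  have fin: "finite (verts M)" "finite (verts H)"
    using M H by (simp_all add: network_def)
  obtain \<alpha> \<beta> :: real where aff: "\<And>u v. u \<in> verts M \<Longrightarrow> v \<in> verts M \<Longrightarrow>
      real (mult H u v) = \<alpha> * real (mult M u v) + (if u = v then \<beta> else 0)"
    using coupling_field_admissible_imp_affine[OF verts fin(1)]
      coupling_field_admissible[OF H] adm by metis
  obtain \<alpha>' \<beta>' :: real where aff': "\<And>u v. u \<in> verts M \<Longrightarrow> v \<in> verts M \<Longrightarrow>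
      real (mult M u v) = \<alpha>' * real (mult H u v) + (if u = v then \<beta>' else 0)"
    using coupling_field_admissible_imp_affine[OF verts[symmetric] fin(2)]
      coupling_field_admissible[OF M(1)] adm verts by metis
  obtain u v where uv: "u \<in> verts M" "v \<in> verts M" "u \<noteq> v" "mult M u v > 0"
    using reduced_network_edge[OF M] .
  have "mult H u v \<noteq> 0"
  proof
    assume "mult H u v = 0"
    then show False
      using aff'[OF uv(1,2)] uv(3,4) by simp
  qed
  then have "\<alpha> * real (mult M u v) > 0"
    using aff[of u v] uv by simp
  then have pos: "\<alpha> > 0"
    by (simp add: zero_less_mult_iff)
  obtain w where w: "w \<in> verts M" "mult M w w = 0"
    using M(2) by (auto simp: reduced_network_def)
  have \<beta>: "\<beta> = real (mult H w w)"
    using aff[of w w] w by simp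
  have "\<alpha> * real (mult M x y) \<in> \<nat>" if "x \<in> verts M" "y \<in> verts M" for x y
  proof -
    have "\<alpha> * real (mult M x y) = real (mult H x y) - (if x = y then real (mult H w w) else 0)"
      using aff[OF that] \<beta> by simp
    then have "\<alpha> * real (mult M x y) \<in> \<int>" by simp
    then show ?thesis
      using pos by (simp add: Nats_altdef2)
  qed
  then have "\<alpha> * real (Gcd {mult M u v |u v. u \<in> verts M \<and> v \<in> verts M \<and> mult M u v > 0}) \<in> \<nat>"
    by (intro real_mult_Gcd_Nats) auto
  then obtain a :: nat where a: "\<alpha> = real a"
    using M(2) by (auto simp: reduced_network_def elim: Nats_cases)
  have "mult H x y = a * mult M x y + (if x = y then mult H w w else 0)"
    if "x \<in> verts M" "y \<in> verts M" for x y
  proof -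
    have "real (mult H x y) = real (a * mult M x y + (if x = y then mult H w w else 0))"
      using aff[OF that] a \<beta> by simp
    then show ?thesis by (simp only: of_nat_eq_iff)
  qed
  then show ?thesis
    using that[of a "mult H w w"] pos a by simp
qed

lemma reduced_num_edges:
  assumes M: "network M" "reduced_network M" and H: "network H"
    and equiv: "ode_equiv M H"
  shows "num_edges M \<le> num_edges H"
    and "num_edges H = num_edges M \<Longrightarrow> isomorphic H M"
proof -
  let ?V = "verts M"
  obtain H' where H': "network H'" "verts H' = ?V" "admissible 1 M = admissible 1 H'"
    and iso: "isomorphic H H'"
    using equiv unfolding ode_equiv_def by blast
  obtain a b :: nat where a: "a > 0" and aff: "\<And>u v. u \<in> ?V \<Longrightarrow> v \<in> ?V \<Longrightarrow>
      mult H' u v = a * mult M u v + (if u = v then b else 0)"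
    using reduced_affine[OF M H'] by blast
  have fin: "finite ?V" using M by (simp add: network_def)
  have edges: "num_edges H = a * num_edges M + b * card ?V"
  proof -
    have "num_edges H' = (\<Sum>u\<in>?V. \<Sum>v\<in>?V. a * mult M u v + (if u = v then b else 0))"
      using aff by (simp add: num_edges_def H')
    also have "\<dots> = a * num_edges M + b * card ?V"
      using fin by (simp add: num_edges_def sum.distrib sum_distrib_left)
    finally show ?thesis
      using num_edges_isomorphic[OF iso] by simp
  qed
  have le: "num_edges M \<le> a * num_edges M"
    using a by simp
  then show "num_edges M \<le> num_edges H"
    using edges by linarith
  assume eq: "num_edges H = num_edges M"
  obtain u v where uv: "u \<in> ?V" "v \<in> ?V" "mult M u v > 0"
    using reduced_network_edge[OF M] by metis
  have "num_edges M \<noteq> 0"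
  proof
    assume "num_edges M = 0"
    then show False
      using uv fin by (simp add: num_edges_def)
  qed
  moreover have "card ?V > 0"
    using uv fin by (auto simp: card_gt_0_iff)
  moreover have "b * card ?V = 0" "a * num_edges M = num_edges M"
    using edges eq le by linarith+
  ultimately have "b = 0" "a = 1"
    by simp_all
  then have "network_iso id H' M"
    using aff H'(2) by (simp add: network_iso_def)
  then show "isomorphic H M"
    using iso isomorphic_iff isomorphic_trans by blast
qed

theorem mainTheorem2:
  fixes G G\<^sub>M :: "'v network"
  assumes "network G" and "network G\<^sub>M"
    and "reduced_network G\<^sub>M" and "ode_equiv G G\<^sub>M"
  shows "G\<^sub>M \<in> ode_class G \<and> minimal_network G\<^sub>M \<and>
    (\<forall>H\<in>ode_class G. minimal_network H \<longrightarrow> isomorphic H G\<^sub>M)"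
proof (intro conjI ballI impI)
  show "G\<^sub>M \<in> ode_class G"
    using assms by (simp add: ode_class_def)
  show "minimal_network G\<^sub>M"
    using assms reduced_num_edges(1) by (auto simp: minimal_network_def ode_class_def)
next
  fix H assume H: "H \<in> ode_class G" and min: "minimal_network H"
  then have nH: "network H" and GH: "ode_equiv G H"
    by (auto simp: ode_class_def)
  have MH: "ode_equiv G\<^sub>M H" and "ode_equiv H G\<^sub>M"
    using ode_equiv_euclidean GH assms(4) by blast+
  then have "num_edges H \<le> num_edges G\<^sub>M"
    using min assms(2) by (auto simp: minimal_network_def ode_class_def)
  then show "isomorphic H G\<^sub>M"
    using reduced_num_edges[OF assms(2,3) nH MH] by simp
qed

end
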